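(* Let $\phi$ be a repulsive, tempered potential on a space $(\mathbb{X},\mu,d)$, where $(\mathbb{X},d)$ is a complete separable metric space, $\mu$ is a locally finite Borel measure, and for every $x\in\mathbb{X}$ the pushforward $\mu_x$ of $\mu$ under $y\mapsto d(y,x)$ is absolutely continuous with respect to Lebesgue measure on $[0,\infty)$. Let $\gamma$ be a damping function and $\lambda\ge0$. If $\lambda<e/\Delta_\phi(\gamma)$, then there is at most one infinite-depth tree recursion $\pi$ adapted to $(\lambda,\gamma)$.
   Context: A potential is a measurable symmetric function $\phi:\mathbb{X}\times\mathbb{X}\to(-\infty,\infty]$; it is repulsive if $\phi\ge0$, and tempered if $C_\phi:=\sup_{v\in\mathbb{X}}\int_{\mathbb{X}}|1-e^{-\phi(x,v)}|\,d\mu(x)<\infty$. Locally finite means finite on bounded Borel sets. Conventions: $e^{-\infty}=0$, $e/0=+\infty$. Damping function: a measurable function $\gamma:\bigcup_{k\ge1}\mathbb{X}^k\to[0,1]$ with $\gamma(v)=1$ for all $v\in\mathbb{X}$ and $\gamma(v_0,v_1,\dots,v_\ell)\le\gamma(v_1,\dots,v_\ell)$ for all $\ell\ge1$ and all $(v_0,\dots,v_\ell)\in\mathbb{X}^{\ell+1}$. Infinite-depth tree recursion adapted to $(\lambda,\gamma)$: a measurable function $\pi:\bigcup_{k\ge1}\mathbb{X}^k\to[0,\lambda]$ such that for each $k\ge0$ and each $(v_0,\dots,v_k)\in\mathbb{X}^{k+1}$, $$\pi(v_0,\dots,v_k)=\lambda\,\gamma(v_0,\dots,v_k)\exp\Big(-\int_{\mathbb{X}}\pi(v_0,\dots,v_k,w)\,(1-e^{-\phi(v_k,w)})\,d\mu(w)\Big).$$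 Connective constant of a damping function: for $k\ge1$, $$V_k(\gamma)=\sup_{v_0\in\mathbb{X}}\int_{\mathbb{X}^k}\prod_{j=1}^k\gamma(v_0,v_1,\dots,v_j)\,\big(1-e^{-\phi(v_j,v_{j-1})}\big)\,d\mu^k(v_1,\dots,v_k),$$ and $\Delta_\phi(\gamma)=\lim_{k\to\infty}V_k(\gamma)^{1/k}=\inf_{k\ge1}V_k(\gamma)^{1/k}$ (the sequence is submultiplicative). *)

theory Defs
  imports "HOL-Analysis.Analysis"
begin

definition locally_finite_borel :: "'a::polish_space measure \<Rightarrow> bool" where
  "locally_finite_borel \<mu> \<longleftrightarrow>
     sets \<mu> = sets borel \<and> (\<forall>A\<in>sets borel. bounded A \<longrightarrow> emeasure \<mu> A < \<infinity>)"

definition dist_pushforwards_ac :: "'a::polish_space measure \<Rightarrow> bool" where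
  "dist_pushforwards_ac \<mu> \<longleftrightarrow>
     (\<forall>x. absolutely_continuous (restrict_space lborel {0..})
            (distr \<mu> (restrict_space borel {0..}) (\<lambda>y. dist y x)))"

definition potential :: "('a::polish_space \<Rightarrow> 'a \<Rightarrow> ereal) \<Rightarrow> bool" where
  "potential \<phi> \<longleftrightarrow>
     (\<lambda>(x, y). \<phi> x y) \<in> borel_measurable (borel \<Otimes>\<^sub>M borel) \<and>
     (\<forall>x y. \<phi> x y = \<phi> y x) \<and> (\<forall>x y. \<phi> x y \<noteq> -\<infinity>)"

definition repulsive :: "('a \<Rightarrow> 'a \<Rightarrow> ereal) \<Rightarrow> bool" where
  "repulsive \<phi> \<longleftrightarrow> (\<forall>x y. 0 \<le> \<phi> x y)"

(* exp (- t) for t > -\<infinity>, with exp (-\<infinity>) = 0; the value at t = -\<infinity> is irrelevant. *)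
definition exp_neg :: "ereal \<Rightarrow> real" where
  "exp_neg t = (if t = \<infinity> then 0 else exp (- real_of_ereal t))"

definition temperedness_const :: "'a::polish_space measure \<Rightarrow> ('a \<Rightarrow> 'a \<Rightarrow> ereal) \<Rightarrow> ennreal" where
  "temperedness_const \<mu> \<phi> = (SUP v. \<integral>\<^sup>+ x. ennreal \<bar>1 - exp_neg (\<phi> x v)\<bar> \<partial>\<mu>)"

definition tempered :: "'a::polish_space measure \<Rightarrow> ('a \<Rightarrow> 'a \<Rightarrow> ereal) \<Rightarrow> bool" where
  "tempered \<mu> \<phi> \<longleftrightarrow> temperedness_const \<mu> \<phi> < \<infinity>"

(* A function on the disjoint union of the spaces X^k, k \<ge> 1, is a function on lists of which only
   the values on nonempty lists matter. It is measurable iff its restriction to each X^k is. *)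
definition tuple_measurable :: "('a::polish_space list \<Rightarrow> real) \<Rightarrow> bool" where
  "tuple_measurable f \<longleftrightarrow>
     (\<forall>k\<ge>1. (\<lambda>x. f (map x [0..<k])) \<in> borel_measurable (\<Pi>\<^sub>M i\<in>{..<k}. borel))"

definition damping_function :: "('a::polish_space list \<Rightarrow> real) \<Rightarrow> bool" where
  "damping_function \<gamma> \<longleftrightarrow>
     tuple_measurable \<gamma> \<and>
     (\<forall>vs. vs \<noteq> [] \<longrightarrow> \<gamma> vs \<in> {0..1}) \<and>
     (\<forall>v. \<gamma> [v] = 1) \<and>
     (\<forall>v vs. vs \<noteq> [] \<longrightarrow> \<gamma> (v # vs) \<le> \<gamma> vs)"

definition tree_recursion ::
  "'a::polish_space measure \<Rightarrow> ('a \<Rightarrow> 'a \<Rightarrow> ereal) \<Rightarrow> real \<Rightarrow> ('a list \<Rightarrow> real) \<Rightarrow> ('a list \<Rightarrow> real) \<Rightarrow> bool" where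
  "tree_recursion \<mu> \<phi> l \<gamma> p \<longleftrightarrow>
     tuple_measurable p \<and>
     (\<forall>vs. vs \<noteq> [] \<longrightarrow> p vs \<in> {0..l}) \<and>
     (\<forall>vs. vs \<noteq> [] \<longrightarrow>
        p vs = l * \<gamma> vs * exp (- (\<integral>w. p (vs @ [w]) * (1 - exp_neg (\<phi> (last vs) w)) \<partial>\<mu>)))"

(* The integration variables v_1, ..., v_k are the values x 1, ..., x k of a point of the product
   space, and v extends x by the starting point at index 0. For repulsive \<phi> the product is
   nonnegative, so the conversion to ennreal does not truncate it. *)
definition V :: "'a::polish_space measure \<Rightarrow> ('a \<Rightarrow> 'a \<Rightarrow> ereal) \<Rightarrow> ('a list \<Rightarrow> real) \<Rightarrow> nat \<Rightarrow> ennreal" where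
  "V \<mu> \<phi> \<gamma> k =
     (SUP v0. \<integral>\<^sup>+ x. (let v = x(0 := v0) in
          ennreal (\<Prod>j=1..k. \<gamma> (map v [0..<Suc j]) * (1 - exp_neg (\<phi> (v j) (v (j - 1))))))
        \<partial>(\<Pi>\<^sub>M i\<in>{1..k}. \<mu>))"

definition ennreal_root :: "nat \<Rightarrow> ennreal \<Rightarrow> ennreal" where
  "ennreal_root k x = (if x = \<infinity> then \<infinity> else ennreal (root k (enn2real x)))"

definition connective_const ::
  "'a::polish_space measure \<Rightarrow> ('a \<Rightarrow> 'a \<Rightarrow> ereal) \<Rightarrow> ('a list \<Rightarrow> real) \<Rightarrow> ennreal" where
  "connective_const \<mu> \<phi> \<gamma> = lim (\<lambda>k. ennreal_root k (V \<mu> \<phi> \<gamma> k))"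

end

theory Submission
  imports Defs
begin

text \<open>
  For two recursions \<open>p\<close> and \<open>q\<close>, square roots turn the recursion into a contraction. With
  \<open>K = 1 - exp(- \<phi>)\<close>, \<open>v\<close> the last entry of \<open>vs\<close> and \<open>s\<^sub>p = \<integral> p(vs w) K(v, w) d\<mu>(w)\<close> one has
  \<open>\<surd>p(vs) = \<surd>(\<lambda>\<gamma>(vs)) exp(- s\<^sub>p / 2)\<close>. The map \<open>x \<mapsto> exp(- x\<^sup>2 / 2)\<close> has Lipschitz constant
  \<open>e\<^bsup>-1/2\<^esup>\<close>, and \<open>|\<surd>s\<^sub>p - \<surd>s\<^sub>q|\<close> is at most the distance of \<open>\<surd>p\<close> and \<open>\<surd>q\<close> in
  \<open>L\<^sup>2(K(v, w) d\<mu>(w))\<close>, so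
  \<open>(\<surd>p - \<surd>q)\<^sup>2(vs) \<le> (\<lambda>\<gamma>(vs) / e) \<integral> (\<surd>p - \<surd>q)\<^sup>2(vs w) K(v, w) d\<mu>(w)\<close>. Iterating \<open>k\<close> times, and
  discarding the prefix by monotonicity of \<open>\<gamma>\<close>, bounds the left side by \<open>\<lambda> (\<lambda>/e)\<^sup>k V\<^sub>k\<close>, which
  tends to 0 when \<open>\<lambda> \<Delta> < e\<close>.
\<close>

section \<open>Real-variable estimates\<close>

text \<open>The derivative \<open>- x * exp (- (x\<^sup>2 / 2))\<close> is largest in modulus at
  \<open>x = 1\<close> and \<open>x = -1\<close>, with value \<open>exp (- (1/2))\<close>. Its
  square is the source of the constant e in the threshold for \<lambda>.\<close>

lemma exp_neg_half_square_lipschitz: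
  fixes a c :: real
  shows "(exp (- (a\<^sup>2 / 2)) - exp (- (c\<^sup>2 / 2)))\<^sup>2 \<le> exp (- 1) * (a - c)\<^sup>2"
proof -
  have bound: "norm (- x * exp (- (x\<^sup>2 / 2))) \<le> exp (- (1/2))" for x :: real
  proof -
    \<comment> \<open>With t = (x^2 - 1)/2 this reads |x| \<le> 1 + t, and 1 + t \<le> exp
      t.\<close>
    have "2 * \<bar>x\<bar> \<le> x\<^sup>2 + 1"
      using sum_squares_bound[of "\<bar>x\<bar>" 1] by simp
    also have "\<dots> / 2 \<le> exp ((x\<^sup>2 - 1) / 2)"
      using exp_ge_add_one_self[of "(x\<^sup>2 - 1) / 2"] by (simp add: field_simps)
    finally have "\<bar>x\<bar> \<le> exp ((x\<^sup>2 - 1) / 2)" by simp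
    then have "\<bar>x\<bar> * exp (- (x\<^sup>2 / 2)) \<le> exp ((x\<^sup>2 - 1) / 2) * exp (- (x\<^sup>2 / 2))"
      by (rule mult_right_mono) simp
    also have "\<dots> = exp (- (1/2))"
      by (simp flip: exp_add add: field_simps)
    finally show ?thesis by (simp add: abs_mult)
  qed
  have "norm (exp (- (a\<^sup>2 / 2)) - exp (- (c\<^sup>2 / 2))) \<le> exp (- (1/2)) * norm (a - c)"
  proof (rule field_differentiable_bound[where S = UNIV])
    show "((\<lambda>x. exp (- (x\<^sup>2 / 2))) has_field_derivative - x * exp (- (x\<^sup>2 / 2)))
            (at x within UNIV)" for x :: real
      by (auto intro!: derivative_eq_intros)
  qed (use bound in auto)
  then have "(exp (- (a\<^sup>2 / 2)) - exp (- (c\<^sup>2 / 2)))\<^sup>2 \<le> (exp (- (1/2)) * \<bar>a - c\<bar>)\<^sup>2"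
    by (metis abs_ge_zero power2_abs power_mono real_norm_def)
  also have "\<dots> = exp (- 1) * (a - c)\<^sup>2"
    by (simp add: power_mult_distrib flip: exp_double)
  finally show ?thesis .
qed

text \<open>Reverse triangle inequality in L^2. It reduces to Cauchy-Schwarz, which follows from the
  nonnegativity of the quadratic form (t, s) -> integral of (t f - s g)^2.\<close>

lemma sqrt_integral_diff_le:
  fixes f g :: "'b \<Rightarrow> real"
  assumes [measurable]: "f \<in> borel_measurable M" "g \<in> borel_measurable M"
    and f: "integrable M (\<lambda>x. (f x)\<^sup>2)" and g: "integrable M (\<lambda>x. (g x)\<^sup>2)"
  shows "(sqrt (\<integral>x. (f x)\<^sup>2 \<partial>M) - sqrt (\<integral>x. (g x)\<^sup>2 \<partial>M))\<^sup>2 \<le> (\<integral>x. (f x - g x)\<^sup>2 \<partial>M)"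
proof -
  have fg: "integrable M (\<lambda>x. f x * g x)"
  proof (rule Bochner_Integration.integrable_bound)
    show "integrable M (\<lambda>x. (f x)\<^sup>2 + (g x)\<^sup>2)" using f g by simp
    have "norm (f x * g x) \<le> norm ((f x)\<^sup>2 + (g x)\<^sup>2)" for x
    proof -
      have "2 * (\<bar>f x\<bar> * \<bar>g x\<bar>) \<le> (f x)\<^sup>2 + (g x)\<^sup>2"
        using sum_squares_bound[of "\<bar>f x\<bar>" "\<bar>g x\<bar>"] by (simp add: mult.assoc)
      moreover have "0 \<le> \<bar>f x\<bar> * \<bar>g x\<bar>" by simp
      ultimately show ?thesis unfolding real_norm_def abs_mult by linarith
    qed
    then show "AE x in M. norm (f x * g x) \<le> norm ((f x)\<^sup>2 + (g x)\<^sup>2)" by simp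
  qed simp
  define A B C where "A = (\<integral>x. (f x)\<^sup>2 \<partial>M)" and "B = (\<integral>x. f x * g x \<partial>M)"
    and "C = (\<integral>x. (g x)\<^sup>2 \<partial>M)"
  have expand: "(\<integral>x. (t * f x - s * g x)\<^sup>2 \<partial>M) = t\<^sup>2 * A - 2 * t * s * B + s\<^sup>2 * C" for t s
  proof -
    have "(\<integral>x. (t * f x - s * g x)\<^sup>2 \<partial>M)
        = (\<integral>x. t\<^sup>2 * (f x)\<^sup>2 - (2 * t * s) * (f x * g x) + s\<^sup>2 * (g x)\<^sup>2 \<partial>M)"
      by (rule Bochner_Integration.integral_cong) (auto simp: power2_eq_square algebra_simps)
    also have "\<dots> = t\<^sup>2 * A - 2 * t * s * B + s\<^sup>2 * C"
      unfolding A_def B_def C_def using f g fg by simp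
    finally show ?thesis .
  qed
  have quad: "0 \<le> t\<^sup>2 * A - 2 * t * s * B + s\<^sup>2 * C" for t s
    unfolding expand[symmetric] by simp
  have A: "0 \<le> A" and C: "0 \<le> C" by (auto simp: A_def C_def)
  have "B \<le> sqrt A * sqrt C"
  proof (rule ccontr)
    assume B: "\<not> ?thesis"
    then have "0 < B" using A C by (smt (verit) mult_nonneg_nonneg real_sqrt_ge_zero)
    consider "A = 0" | "C = 0" | "0 < A" "0 < C" using A C by linarith
    then show False
    \<comment> \<open>In the degenerate cases the chosen arguments make the quadratic form equal to
      -1.\<close>
    proof cases
      case 1
      then show False using quad[of "(C + 1) / (2 * B)" 1] \<open>0 < B\<close> by simp
    next
      case 2
      then show False using quad[of 1 "(A + 1) / (2 * B)"] \<open>0 < B\<close> by simp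
    next
      case 3
      define a c where "a = sqrt A" and "c = sqrt C"
      have ac: "A = a\<^sup>2" "C = c\<^sup>2" "0 < a" "0 < c"
        using 3 by (simp_all add: a_def c_def)
      \<comment> \<open>At t = c, s = a the form factors as 2ac(ac - B).\<close>
      have "0 \<le> 2 * (a * c) * (a * c - B)"
        using quad[of c a] by (simp add: ac power2_eq_square algebra_simps)
      moreover have "0 < 2 * (a * c)" using ac by simp
      ultimately have "B \<le> a * c"
        using mult_pos_neg[of "2 * (a * c)" "a * c - B"] by linarith
      then show False using B by (simp add: a_def c_def)
    qed
  qed
  then have "A + C - 2 * (sqrt A * sqrt C) \<le> A - 2 * B + C" by simp
  then show ?thesis
    using expand[of 1 1] A C by (simp add: power2_diff flip: A_def C_def)
qed

text \<open>Fekete's lemma in multiplicative form: the limit is the infimum over n \<ge> 1. Working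
  with roots instead of logarithms admits \<open>v n = 0\<close>.\<close>

lemma fekete_convergent_root:
  fixes v :: "nat \<Rightarrow> real"
  assumes nonneg: "\<And>n. 0 \<le> v n" and sub: "\<And>m n. v (m + n) \<le> v m * v n"
  shows "convergent (\<lambda>n. root n (v n))"
proof -
  define S where "S = (\<lambda>n. root n (v n)) ` {1..}"
  define L where "L = Inf S"
  have bdd: "bdd_below S" unfolding S_def by (rule bdd_belowI2[of _ 0]) (simp add: nonneg)
  have "0 \<le> L" unfolding L_def S_def by (rule cINF_greatest) (auto simp: nonneg)
  have lower: "L \<le> root n (v n)" if "n \<ge> 1" for n
    unfolding L_def using bdd that by (intro cInf_lower) (auto simp: S_def)
  have upper: "eventually (\<lambda>n. root n (v n) < a) sequentially" if "L < a" for a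
  proof -
    obtain r where r: "L < r" "r < a" using dense[OF \<open>L < a\<close>] by auto
    have "0 < r" using r \<open>0 \<le> L\<close> by simp
    obtain m where m: "m \<ge> 1" "root m (v m) < r"
      using r(1) bdd unfolding L_def S_def by (subst (asm) cINF_less_iff) auto
    have vm: "v m \<le> r ^ m"
      using m nonneg[of m] \<open>0 < r\<close>
      by (metis less_eq_real_def power_mono real_root_ge_zero real_root_pow_pos2 One_nat_def Suc_le_eq)
    \<comment> \<open>Stripping blocks of length m from n leaves a remainder i < m, and c dominates
      every \<open>v i / r ^ i\<close>. The summand 1 keeps c positive, so that
      \<open>root n c\<close> tends to 1.\<close>
    define c where "c = 1 + (\<Sum>i<m. v i / r ^ i)"
    have "0 < c" unfolding c_def using nonneg \<open>0 < r\<close> by (intro add_pos_nonneg sum_nonneg) auto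
    have vn: "v n \<le> c * r ^ n" for n
    proof (induction n rule: less_induct)
      case (less n)
      show ?case
      proof (cases "n < m")
        case True
        have "v n / r ^ n \<le> (\<Sum>i<m. v i / r ^ i)"
          using True nonneg \<open>0 < r\<close> by (intro member_le_sum) auto
        then have "v n / r ^ n \<le> c" by (simp add: c_def)
        then show ?thesis using \<open>0 < r\<close> by (simp add: field_simps)
      next
        case False
        then have "v n \<le> v m * v (n - m)" using sub[of m "n - m"] by simp
        also have "\<dots> \<le> r ^ m * (c * r ^ (n - m))"
          using vm less.IH[of "n - m"] False m nonneg \<open>0 < r\<close> by (intro mult_mono) auto
        also have "\<dots> = c * r ^ n" using False by (simp flip: power_add)
        finally show ?thesis .
      qed
    qed
    have "(\<lambda>n. root n c * r) \<longlonglongrightarrow> 1 * r"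
      by (intro tendsto_intros LIMSEQ_root_const \<open>0 < c\<close>)
    then have "eventually (\<lambda>n. root n c * r < a) sequentially"
      using r(2) by (intro order_tendstoD(2)) auto
    then show ?thesis
      using eventually_gt_at_top[of 0]
    proof eventually_elim
      case (elim n)
      have "root n (v n) \<le> root n (c * r ^ n)" using vn elim by simp
      also have "\<dots> = root n c * r" using elim \<open>0 < r\<close> by (simp add: real_root_mult real_root_power_cancel)
      finally show ?case using elim by simp
    qed
  qed
  have "(\<lambda>n. root n (v n)) \<longlonglongrightarrow> L"
  proof (rule order_tendstoI)
    fix a assume "a < L"
    show "eventually (\<lambda>n. a < root n (v n)) sequentially"
      using eventually_ge_at_top[of 1] by eventually_elim (rule less_le_trans[OF \<open>a < L\<close> lower])
  qed (fact upper)
  then show ?thesis by (rule convergentI)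
qed


section \<open>Measurability of functions on tuples\<close>

text \<open>Points of the product space are extensional, so \<open>g z\<close> is first restricted
  to \<open>{..<n}\<close>; the list reads only these indices and does not change.\<close>

lemma measurable_tuple_compose:
  fixes f :: "'a::topological_space list \<Rightarrow> 'b::topological_space"
  assumes "(\<lambda>x. f (map x [0..<n])) \<in> borel_measurable (\<Pi>\<^sub>M i\<in>{..<n}. borel)"
    and "\<And>i. i < n \<Longrightarrow> (\<lambda>z. g z i) \<in> borel_measurable M"
  shows "(\<lambda>z. f (map (g z) [0..<n])) \<in> borel_measurable M"
proof -
  have "(\<lambda>z. \<lambda>i\<in>{..<n}. g z i) \<in> measurable M (\<Pi>\<^sub>M i\<in>{..<n}. borel)"
    using assms(2) by (intro measurable_restrict) auto
  from measurable_compose[OF this assms(1)]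
  have "(\<lambda>z. f (map (\<lambda>i\<in>{..<n}. g z i) [0..<n])) \<in> borel_measurable M" .
  moreover have "map (\<lambda>i\<in>{..<n}. g z i) [0..<n] = map (g z) [0..<n]" for z
    by (rule map_cong) auto
  ultimately show ?thesis by simp
qed

lemma measurable_tuple_snoc:
  fixes f :: "'a::topological_space list \<Rightarrow> 'b::topological_space"
  assumes "(\<lambda>x. f (map x [0..<Suc (length vs)]))
             \<in> borel_measurable (\<Pi>\<^sub>M i\<in>{..<Suc (length vs)}. borel)"
  shows "(\<lambda>w. f (vs @ [w])) \<in> borel_measurable borel"
proof -
  have "(\<lambda>w. (vs @ [w]) ! i) \<in> borel_measurable borel" if "i < Suc (length vs)" for i
    using that by (cases "i < length vs") (auto simp: nth_append)
  with assms have "(\<lambda>w. f (map ((!) (vs @ [w])) [0..<Suc (length vs)])) \<in> borel_measurable borel"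
    by (rule measurable_tuple_compose)
  moreover have "map ((!) (vs @ [w])) [0..<Suc (length vs)] = vs @ [w]" for w
    using map_nth[of "vs @ [w]"] by (simp del: upt_Suc)
  ultimately show ?thesis by simp
qed

section \<open>Damped kernels and their iterated integrals\<close>

locale damped_potential =
  fixes \<mu> :: "'a::polish_space measure" and \<phi> :: "'a \<Rightarrow> 'a \<Rightarrow> ereal" and \<gamma> :: "'a list \<Rightarrow> real"
  assumes locally_finite: "locally_finite_borel \<mu>"
    and potential: "potential \<phi>" and repulsive: "repulsive \<phi>" and tempered: "tempered \<mu> \<phi>"
    and damping: "damping_function \<gamma>"
begin

section \<open>Basic properties of the kernel, the measure and the damping function\<close>

text \<open>The negative of the Mayer function of \<phi>.\<close>

definition K :: "'a \<Rightarrow> 'a \<Rightarrow> real" where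
  "K v w = 1 - exp_neg (\<phi> v w)"

lemma K_commute: "K v w = K w v"
  using potential by (simp add: K_def potential_def)

lemma K_nonneg [simp]: "0 \<le> K v w"
  using repulsive by (auto simp: K_def exp_neg_def repulsive_def real_of_ereal_pos)

lemma sets_mu [measurable_cong]: "sets \<mu> = sets borel"
  using locally_finite by (simp add: locally_finite_borel_def)

lemma space_mu [simp]: "space \<mu> = UNIV"
  using sets_eq_imp_space_eq[OF sets_mu] by simp

lemma sigma_finite_mu: "sigma_finite_measure \<mu>"
proof
  \<comment> \<open>\<open>undefined\<close> serves as an arbitrary centre; balls of integer radius
    around it are bounded and cover the space.\<close>
  let ?A = "range (\<lambda>n::nat. cball (undefined :: 'a) n)"
  have "x \<in> \<Union>?A" for x
    using real_arch_simple[of "dist undefined x"] by auto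
  moreover have "emeasure \<mu> a < \<infinity>" if "a \<in> ?A" for a
    using locally_finite that by (auto simp: locally_finite_borel_def)
  ultimately show "\<exists>A. countable A \<and> A \<subseteq> sets \<mu> \<and> \<Union>A = space \<mu> \<and> (\<forall>a\<in>A. emeasure \<mu> a \<noteq> \<infinity>)"
    by (intro exI[of _ ?A]) (auto simp: sets_mu less_top[symmetric])
qed

sublocale sigma_finite_measure \<mu>
  by (rule sigma_finite_mu)

sublocale product_sigma_finite "\<lambda>_ :: nat. \<mu>"
  by standard

lemma measurable_K [measurable]:
  assumes [measurable]: "f \<in> borel_measurable M" "g \<in> borel_measurable M"
  shows "(\<lambda>z. K (f z) (g z)) \<in> borel_measurable M"
proof -
  have [measurable]: "(\<lambda>(x, y). \<phi> x y) \<in> borel_measurable (borel \<Otimes>\<^sub>M borel)"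
    using potential by (simp add: potential_def)
  have [measurable]: "exp_neg \<in> borel_measurable borel"
    unfolding exp_neg_def by measurable
  have "(\<lambda>z. (f z, g z)) \<in> measurable M (borel \<Otimes>\<^sub>M borel)" by measurable
  from measurable_compose[OF this \<open>(\<lambda>(x, y). \<phi> x y) \<in> _\<close>]
  have [measurable]: "(\<lambda>z. \<phi> (f z) (g z)) \<in> borel_measurable M" by simp
  show ?thesis unfolding K_def by measurable
qed

lemma nn_integral_K_le: "(\<integral>\<^sup>+ w. ennreal (K v w) \<partial>\<mu>) \<le> temperedness_const \<mu> \<phi>"
proof -
  have "(\<integral>\<^sup>+ w. ennreal (K v w) \<partial>\<mu>) = (\<integral>\<^sup>+ w. ennreal \<bar>1 - exp_neg (\<phi> w v)\<bar> \<partial>\<mu>)"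
    using K_nonneg[of _ v] by (simp add: K_commute[of v] flip: K_def)
  then show ?thesis unfolding temperedness_const_def by (auto intro: SUP_upper)
qed

lemma integrable_K: "integrable \<mu> (K v)"
proof (rule integrableI_nonneg)
  show "(\<integral>\<^sup>+ w. ennreal (K v w) \<partial>\<mu>) < \<infinity>"
    using nn_integral_K_le tempered unfolding tempered_def by (rule le_less_trans)
qed auto

lemma gamma_nonneg: "vs \<noteq> [] \<Longrightarrow> 0 \<le> \<gamma> vs" and gamma_le_1: "vs \<noteq> [] \<Longrightarrow> \<gamma> vs \<le> 1"
  using damping by (auto simp: damping_function_def)

lemma gamma_append_le: "vs \<noteq> [] \<Longrightarrow> \<gamma> (us @ vs) \<le> \<gamma> vs"
proof (induction us)
  case (Cons u us)
  then have "\<gamma> (u # us @ vs) \<le> \<gamma> (us @ vs)"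
    using damping by (auto simp: damping_function_def)
  with Cons show ?case by simp
qed simp

lemma measurable_gamma:
  "n \<ge> 1 \<Longrightarrow> (\<lambda>x. \<gamma> (map x [0..<n])) \<in> borel_measurable (\<Pi>\<^sub>M i\<in>{..<n}. borel)"
  using damping by (simp add: damping_function_def tuple_measurable_def)

lemma measurable_gamma_snoc [measurable]: "(\<lambda>w. \<gamma> (vs @ [w])) \<in> borel_measurable borel"
  by (intro measurable_tuple_snoc measurable_gamma) simp

section \<open>Iterated integrals along paths\<close>

text \<open>Total weight of the k-step continuations of the path \<open>vs\<close>. The whole
  history stays an argument because \<gamma> depends on it; the factor \<open>\<gamma> vs\<close>
  itself is not included.\<close>

primrec W :: "nat \<Rightarrow> 'a list \<Rightarrow> ennreal" where
  "W 0 vs = 1"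
| "W (Suc k) vs = (\<integral>\<^sup>+ w. ennreal (\<gamma> (vs @ [w]) * K (last vs) w) * W k (vs @ [w]) \<partial>\<mu>)"

text \<open>The induction is over all n at once, since unfolding \<open>W\<close> appends a
  coordinate. Joint measurability of the integrand in the path and the new point is obtained by
  writing the longer path as an update at index n.\<close>

lemma measurable_W:
  "n \<ge> 1 \<Longrightarrow> (\<lambda>x. W k (map x [0..<n])) \<in> borel_measurable (\<Pi>\<^sub>M i\<in>{..<n}. borel)"
proof (induction k arbitrary: n)
  case (Suc k)
  let ?P = "(\<Pi>\<^sub>M i\<in>{..<n}. borel) \<Otimes>\<^sub>M \<mu> :: ((nat \<Rightarrow> 'a) \<times> 'a) measure"
  have comp: "(\<lambda>z. ((fst z)(n := snd z)) i) \<in> borel_measurable ?P" if "i < Suc n" for i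
    using that by (cases "i = n") (auto intro!: measurable_compose[OF measurable_fst])
  have snoc: "map (x(n := w)) [0..<Suc n] = map x [0..<n] @ [w]" for x :: "nat \<Rightarrow> 'a" and w
    by simp
  have last: "last (map x [0..<n]) = x (n - 1)" for x :: "nat \<Rightarrow> 'a"
    using Suc.prems by (simp add: last_map)
  have [measurable]: "(\<lambda>z. \<gamma> (map (fst z) [0..<n] @ [snd z])) \<in> borel_measurable ?P"
    unfolding snoc[symmetric] by (rule measurable_tuple_compose[OF measurable_gamma comp]) simp_all
  have [measurable]: "(\<lambda>z. W k (map (fst z) [0..<n] @ [snd z])) \<in> borel_measurable ?P"
    unfolding snoc[symmetric] by (rule measurable_tuple_compose[OF Suc.IH comp]) simp_all
  have [measurable]: "(\<lambda>z. fst z (n - 1)) \<in> borel_measurable ?P"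
    using Suc.prems by (auto intro!: measurable_compose[OF measurable_fst])
  have "(\<lambda>x. \<integral>\<^sup>+ w. ennreal (\<gamma> (map x [0..<n] @ [w]) * K (x (n - 1)) w) * W k (map x [0..<n] @ [w]) \<partial>\<mu>)
      \<in> borel_measurable (\<Pi>\<^sub>M i\<in>{..<n}. borel)"
    by (rule borel_measurable_nn_integral) (unfold split_beta', measurable)
  then show ?case by (simp add: last)
qed simp

lemma measurable_W_snoc [measurable]: "(\<lambda>w. W k (vs @ [w])) \<in> borel_measurable borel"
  by (intro measurable_tuple_snoc measurable_W) simp

text \<open>The kernels see only consecutive points and are unaffected by the prefix
  \<open>us\<close>; only the damping factors change, and they grow when it is dropped.\<close>

lemma W_append_le: "vs \<noteq> [] \<Longrightarrow> W k (us @ vs) \<le> W k vs"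
proof (induction k arbitrary: vs)
  case (Suc k)
  have "ennreal (\<gamma> (us @ vs @ [w]) * K (last vs) w) * W k (us @ vs @ [w])
      \<le> ennreal (\<gamma> (vs @ [w]) * K (last vs) w) * W k (vs @ [w])" for w
    using Suc.IH[of "vs @ [w]"] gamma_append_le[of "vs @ [w]" us]
    by (intro mult_mono ennreal_leI mult_right_mono) auto
  then show ?case using Suc.prems by (auto intro!: nn_integral_mono)
qed simp

text \<open>The point \<open>y\<close> supplies the entries up to index \<open>m\<close>, which stay fixed.\<close>

lemma nn_integral_path_weight:
  defines "glue \<equiv> \<lambda>m (y :: nat \<Rightarrow> 'a) x i. if i \<le> m then y i else x i"
  shows "(\<integral>\<^sup>+ x. (\<Prod>j\<in>{Suc m..m + k}. ennreal (\<gamma> (map (glue m y x) [0..<Suc j])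
            * K (glue m y x (j - 1)) (glue m y x j))) \<partial>(\<Pi>\<^sub>M i\<in>{Suc m..m + k}. \<mu>))
         = W k (map y [0..<Suc m])"
proof (induction k arbitrary: m y)
  case 0
  then show ?case by (simp add: PiM_empty)
next
  case (Suc k)
  define F where "F m y j x = ennreal (\<gamma> (map (glue m y x) [0..<Suc j])
            * K (glue m y x (j - 1)) (glue m y x j))" for m y j x
  have F_meas: "F m y j \<in> borel_measurable (\<Pi>\<^sub>M i\<in>{Suc m..m + k}. \<mu>)" if "j \<in> {Suc m..m + k}" for m y j k
  proof -
    have comp: "(\<lambda>x. glue m y x i) \<in> borel_measurable (\<Pi>\<^sub>M i\<in>{Suc m..m + k}. \<mu>)" if "i \<le> j" for i
    proof (cases "i \<le> m")
      case False
      then have "(\<lambda>x. x i) \<in> measurable (\<Pi>\<^sub>M i\<in>{Suc m..m + k}. \<mu>) \<mu>"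
        using that \<open>j \<in> _\<close> by (intro measurable_component_singleton) auto
      then show ?thesis using False by (simp add: glue_def measurable_cong_sets[OF refl sets_mu])
    qed (simp add: glue_def)
    have [measurable]: "(\<lambda>x. \<gamma> (map (glue m y x) [0..<Suc j])) \<in> borel_measurable (\<Pi>\<^sub>M i\<in>{Suc m..m + k}. \<mu>)"
      by (rule measurable_tuple_compose[OF measurable_gamma comp]) auto
    have [measurable]: "(\<lambda>x. glue m y x (j - 1)) \<in> borel_measurable (\<Pi>\<^sub>M i\<in>{Suc m..m + k}. \<mu>)"
      "(\<lambda>x. glue m y x j) \<in> borel_measurable (\<Pi>\<^sub>M i\<in>{Suc m..m + k}. \<mu>)"
      by (rule comp; simp)+
    show ?thesis unfolding F_def by measurable
  qed
  define I where "I = {Suc (Suc m)..Suc m + k}"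
  have insert: "{Suc m..m + Suc k} = insert (Suc m) I" and I: "finite I" "Suc m \<notin> I"
    by (auto simp: I_def)
  have meas: "(\<lambda>x. \<Prod>j\<in>{Suc m..m + Suc k}. F m y j x) \<in> borel_measurable (\<Pi>\<^sub>M i\<in>{Suc m..m + Suc k}. \<mu>)"
    by (intro borel_measurable_prod_ennreal F_meas)
  \<comment> \<open>Moving the integration variable w into the fixed part turns the claim for m into
    the one for \<open>Suc m\<close>, to which the induction hypothesis applies.\<close>
  have upd: "F m y j (x(Suc m := w)) = F (Suc m) (y(Suc m := w)) j x" for j x w
  proof -
    have "glue m y (x(Suc m := w)) = glue (Suc m) (y(Suc m := w)) x"
      by (auto simp: glue_def fun_eq_iff)
    then show ?thesis by (simp add: F_def del: upt_Suc)
  qed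
  \<comment> \<open>The factor at j = \<open>Suc m\<close> does not depend on x, so it leaves the
    inner integral.\<close>
  have first: "F (Suc m) (y(Suc m := w)) (Suc m) x
      = ennreal (\<gamma> (map y [0..<Suc m] @ [w]) * K (y m) w)" for x w
  proof -
    have "map (glue (Suc m) (y(Suc m := w)) x) [0..<Suc (Suc m)] = map y [0..<Suc m] @ [w]"
      by (auto simp: glue_def)
    then show ?thesis by (simp add: F_def glue_def del: upt_Suc)
  qed
  have "(\<integral>\<^sup>+ x. (\<Prod>j\<in>{Suc m..m + Suc k}. F m y j x) \<partial>(\<Pi>\<^sub>M i\<in>{Suc m..m + Suc k}. \<mu>))
      = (\<integral>\<^sup>+ w. \<integral>\<^sup>+ x. (\<Prod>j\<in>insert (Suc m) I. F m y j (x(Suc m := w))) \<partial>(\<Pi>\<^sub>M i\<in>I. \<mu>) \<partial>\<mu>)"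
    using product_nn_integral_insert_rev[OF I meas[unfolded insert]] unfolding insert .
  also have "\<dots> = (\<integral>\<^sup>+ w. \<integral>\<^sup>+ x. ennreal (\<gamma> (map y [0..<Suc m] @ [w]) * K (y m) w)
        * (\<Prod>j\<in>I. F (Suc m) (y(Suc m := w)) j x) \<partial>(\<Pi>\<^sub>M i\<in>I. \<mu>) \<partial>\<mu>)"
    unfolding upd prod.insert[OF I] first ..
  also have "\<dots> = (\<integral>\<^sup>+ w. ennreal (\<gamma> (map y [0..<Suc m] @ [w]) * K (y m) w)
        * (\<integral>\<^sup>+ x. (\<Prod>j\<in>I. F (Suc m) (y(Suc m := w)) j x) \<partial>(\<Pi>\<^sub>M i\<in>I. \<mu>)) \<partial>\<mu>)"
    unfolding I_def
    by (intro nn_integral_cong nn_integral_cmult borel_measurable_prod_ennreal F_meas)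
  also have "\<dots> = (\<integral>\<^sup>+ w. ennreal (\<gamma> (map y [0..<Suc m] @ [w]) * K (y m) w)
        * W k (map y [0..<Suc m] @ [w]) \<partial>\<mu>)"
  proof -
    have "(\<integral>\<^sup>+ x. (\<Prod>j\<in>I. F (Suc m) (y(Suc m := w)) j x) \<partial>(\<Pi>\<^sub>M i\<in>I. \<mu>))
        = W k (map y [0..<Suc m] @ [w])" for w
    proof -
      have "map (y(Suc m := w)) [0..<Suc (Suc m)] = map y [0..<Suc m] @ [w]" by simp
      then show ?thesis
        using Suc.IH[of "Suc m" "y(Suc m := w)"] by (simp only: F_def I_def)
    qed
    then show ?thesis by simp
  qed
  also have "\<dots> = W (Suc k) (map y [0..<Suc m])" by simp
  finally show ?case by (simp only: F_def)
qed

text \<open>Tonelli in the form of \<open>nn_integral_path_weight\<close> with m = 0, where only the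
  starting point is fixed. The kernel arguments occur in the opposite order in \<open>V\<close>,
  which the symmetry of \<phi> repairs.\<close>

lemma V_eq_SUP_W: "V \<mu> \<phi> \<gamma> k = (SUP v. W k [v])"
proof -
  have "(\<integral>\<^sup>+ x. (let v = x(0 := v0) in
            ennreal (\<Prod>j=1..k. \<gamma> (map v [0..<Suc j]) * (1 - exp_neg (\<phi> (v j) (v (j - 1))))))
          \<partial>(\<Pi>\<^sub>M i\<in>{1..k}. \<mu>)) = W k [v0]" (is "?lhs = _") for v0
  proof -
    define g where "g = (\<lambda>(x :: nat \<Rightarrow> 'a) i. if i \<le> 0 then v0 else x i)"
    have g: "x(0 := v0) = g x" for x
      by (auto simp: g_def)
    have "(let v = x(0 := v0) in
            ennreal (\<Prod>j=1..k. \<gamma> (map v [0..<Suc j]) * (1 - exp_neg (\<phi> (v j) (v (j - 1))))))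
        = (\<Prod>j=1..k. ennreal (\<gamma> (map (g x) [0..<Suc j]) * K (g x (j - 1)) (g x j)))" for x
      unfolding Let_def g K_def[symmetric] K_commute[of "g x (_ - 1)"]
      by (rule prod_ennreal[symmetric]) (auto intro!: mult_nonneg_nonneg gamma_nonneg simp del: upt_Suc)
    then have "?lhs = (\<integral>\<^sup>+ x. (\<Prod>j=1..k. ennreal (\<gamma> (map (g x) [0..<Suc j]) * K (g x (j - 1)) (g x j)))
        \<partial>(\<Pi>\<^sub>M i\<in>{1..k}. \<mu>))"
      by (simp only:)
    also have "\<dots> = W k (map (\<lambda>_. v0) [0..<Suc 0])"
      using nn_integral_path_weight[of 0 k "\<lambda>_. v0"] by (simp only: g_def add_0 One_nat_def)
    finally show ?thesis by simp
  qed
  then show ?thesis unfolding V_def by simp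
qed

text \<open>Forgetting all of the history except its last point can only increase
  \<open>W\<close>.\<close>

lemma W_le_V: "vs \<noteq> [] \<Longrightarrow> W k vs \<le> V \<mu> \<phi> \<gamma> k"
  using W_append_le[of "[last vs]" k "butlast vs"]
  by (auto simp: V_eq_SUP_W intro: SUP_upper2)

section \<open>Submultiplicativity and the growth rate of \<open>V\<close>\<close>

text \<open>After the first m steps, the remaining n contribute at most
  \<open>V \<mu> \<phi> \<gamma> n\<close>, uniformly in the history reached.\<close>

lemma W_add_le: "vs \<noteq> [] \<Longrightarrow> W (m + n) vs \<le> W m vs * V \<mu> \<phi> \<gamma> n"
proof (induction m arbitrary: vs)
  case 0
  then show ?case by (simp add: W_le_V)
next
  case (Suc m)
  have "W (Suc m + n) vs
      \<le> (\<integral>\<^sup>+ w. ennreal (\<gamma> (vs @ [w]) * K (last vs) w) * W m (vs @ [w]) * V \<mu> \<phi> \<gamma> n \<partial>\<mu>)"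
    using Suc.IH by (auto intro!: nn_integral_mono mult_left_mono simp: mult.assoc)
  also have "\<dots> = W (Suc m) vs * V \<mu> \<phi> \<gamma> n"
    by (simp add: nn_integral_multc)
  finally show ?case .
qed

lemma V_add_le: "V \<mu> \<phi> \<gamma> (m + n) \<le> V \<mu> \<phi> \<gamma> m * V \<mu> \<phi> \<gamma> n"
  unfolding V_eq_SUP_W[of "m + n"]
proof (rule SUP_least)
  fix v
  show "W (m + n) [v] \<le> V \<mu> \<phi> \<gamma> m * V \<mu> \<phi> \<gamma> n"
    by (rule order_trans[OF W_add_le mult_right_mono[OF W_le_V]]) simp_all
qed

text \<open>Since \<gamma> \<le> 1, one step costs at most the temperedness constant;
  submultiplicativity gives the rest.\<close>

lemma V_finite: "V \<mu> \<phi> \<gamma> k < \<infinity>"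
proof (induction k)
  case 0
  then show ?case by (simp add: V_eq_SUP_W)
next
  case (Suc k)
  have "W 1 [v] \<le> temperedness_const \<mu> \<phi>" for v
  proof -
    have "W 1 [v] \<le> (\<integral>\<^sup>+ w. ennreal (K v w) \<partial>\<mu>)"
      using gamma_nonneg gamma_le_1
      by (auto intro!: nn_integral_mono ennreal_leI mult_left_le_one_le)
    then show ?thesis using nn_integral_K_le order_trans by blast
  qed
  then have "V \<mu> \<phi> \<gamma> 1 \<le> temperedness_const \<mu> \<phi>"
    unfolding V_eq_SUP_W by (rule SUP_least)
  then have "V \<mu> \<phi> \<gamma> 1 < \<infinity>"
    using tempered by (auto simp: tempered_def)
  then show ?case
    using V_add_le[of 1 k] Suc.IH by (auto intro: le_less_trans simp: ennreal_mult_less_top)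
qed

text \<open>\<open>connective_const\<close> is given by \<open>lim\<close>, which is informative
  only once convergence is known. Finiteness of \<open>V\<close> allows a passage to the reals,
  where Fekete's lemma applies.\<close>

lemma root_V_tendsto:
  obtains L where "0 \<le> L" "connective_const \<mu> \<phi> \<gamma> = ennreal L"
    and "(\<lambda>k. root k (enn2real (V \<mu> \<phi> \<gamma> k))) \<longlonglongrightarrow> L"
proof -
  let ?v = "\<lambda>k. enn2real (V \<mu> \<phi> \<gamma> k)"
  have "?v (m + n) \<le> ?v m * ?v n" for m n
    using V_add_le[of m n] V_finite
    by (metis enn2real_mono enn2real_mult ennreal_mult_less_top infinity_ennreal_def)
  then have "convergent (\<lambda>k. root k (?v k))"
    by (intro fekete_convergent_root) auto
  then obtain L where L: "(\<lambda>k. root k (?v k)) \<longlonglongrightarrow> L"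
    unfolding convergent_def by blast
  have "0 \<le> root k (?v k)" for k by (cases "k = 0") auto
  then have "0 \<le> L" using L by (intro LIMSEQ_le_const) auto
  have "(\<lambda>k. ennreal_root k (V \<mu> \<phi> \<gamma> k)) \<longlonglongrightarrow> ennreal L"
    using L V_finite by (simp add: ennreal_root_def less_top[symmetric] tendsto_ennrealI)
  then have "connective_const \<mu> \<phi> \<gamma> = ennreal L"
    unfolding connective_const_def by (rule limI)
  with \<open>0 \<le> L\<close> show thesis using L by (rule that)
qed

section \<open>Contraction of tree recursions\<close>

lemma tree_recursionD:
  assumes "tree_recursion \<mu> \<phi> l \<gamma> p"
  shows "tuple_measurable p" "vs \<noteq> [] \<Longrightarrow> p vs \<in> {0..l}"
    "vs \<noteq> [] \<Longrightarrow> p vs = l * \<gamma> vs * exp (- (\<integral>w. p (vs @ [w]) * K (last vs) w \<partial>\<mu>))"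
  using assms unfolding tree_recursion_def K_def by blast+

lemma tree_recursion_le:
  assumes p: "tree_recursion \<mu> \<phi> l \<gamma> p" and "0 \<le> l" and vs: "vs \<noteq> []"
  shows "p vs \<le> l * \<gamma> vs"
proof -
  have "0 \<le> (\<integral>w. p (vs @ [w]) * K (last vs) w \<partial>\<mu>)"
    using tree_recursionD(2)[OF p] by (intro Bochner_Integration.integral_nonneg) auto
  then show ?thesis
    unfolding tree_recursionD(3)[OF p vs] using \<open>0 \<le> l\<close> gamma_nonneg[OF vs]
    by (simp add: mult_left_le)
qed

text \<open>The Lipschitz bound yields the factor 1/e, and the reverse triangle inequality in L^2
  moves the difference under the integral. A nonnegative integral on the right lets the estimate be
  iterated without integrability conditions.\<close>

lemma sqrt_tree_recursion_contraction:
  assumes p: "tree_recursion \<mu> \<phi> l \<gamma> p" and q: "tree_recursion \<mu> \<phi> l \<gamma> q"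
    and "0 \<le> l" and vs: "vs \<noteq> []"
  shows "ennreal ((sqrt (p vs) - sqrt (q vs))\<^sup>2)
    \<le> ennreal (l * \<gamma> vs / exp 1)
      * (\<integral>\<^sup>+ w. ennreal (K (last vs) w * (sqrt (p (vs @ [w])) - sqrt (q (vs @ [w])))\<^sup>2) \<partial>\<mu>)"
proof -
  \<comment> \<open>Absorbing the square root of the kernel into \<open>h\<close> turns the weighted
    L^2 norm into the plain one for \<mu>; \<open>s r\<close> is the exponent in the
    recursion.\<close>
  define h where "h r w = sqrt (r (vs @ [w]) * K (last vs) w)" for r :: "'a list \<Rightarrow> real" and w
  define s where "s r = (\<integral>w. (h r w)\<^sup>2 \<partial>\<mu>)" for r
  have rec: "h r \<in> borel_measurable \<mu>" "integrable \<mu> (\<lambda>w. (h r w)\<^sup>2)"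
    "sqrt (r vs) = sqrt (l * \<gamma> vs) * exp (- ((sqrt (s r))\<^sup>2 / 2))"
    if r: "tree_recursion \<mu> \<phi> l \<gamma> r" for r
  proof -
    have [measurable]: "(\<lambda>w. r (vs @ [w])) \<in> borel_measurable borel"
      using tree_recursionD(1)[OF r] by (intro measurable_tuple_snoc) (simp add: tuple_measurable_def del: upt_Suc)
    have nonneg: "0 \<le> r us" and le: "r us \<le> l" if "us \<noteq> []" for us
      using tree_recursionD(2)[OF r that] by auto
    have h2: "(h r w)\<^sup>2 = r (vs @ [w]) * K (last vs) w" for w
      using nonneg by (simp add: h_def)
    show [measurable]: "h r \<in> borel_measurable \<mu>" unfolding h_def by measurable
    \<comment> \<open>Temperedness enters here: since r is at most l, the integrand is dominated by
      l times an integrable kernel.\<close>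
    show "integrable \<mu> (\<lambda>w. (h r w)\<^sup>2)"
    proof (rule Bochner_Integration.integrable_bound)
      show "integrable \<mu> (\<lambda>w. l * K (last vs) w)" using integrable_K by simp
      show "AE w in \<mu>. norm ((h r w)\<^sup>2) \<le> norm (l * K (last vs) w)"
        using nonneg le \<open>0 \<le> l\<close> by (auto simp: h2 abs_mult intro!: mult_right_mono)
    qed simp
    have "0 \<le> s r" by (simp add: s_def)
    have "r vs = l * \<gamma> vs * exp (- s r)"
      unfolding s_def h2 by (rule tree_recursionD(3)[OF r vs])
    also have "exp (- s r) = (exp (- (s r / 2)))\<^sup>2"
      by (simp flip: exp_double)
    finally show "sqrt (r vs) = sqrt (l * \<gamma> vs) * exp (- ((sqrt (s r))\<^sup>2 / 2))"
      using \<open>0 \<le> s r\<close> by (simp add: real_sqrt_mult)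
  qed
  have nonneg: "0 \<le> l * \<gamma> vs" using \<open>0 \<le> l\<close> gamma_nonneg[OF vs] by simp
  have "(sqrt (p vs) - sqrt (q vs))\<^sup>2
      = l * \<gamma> vs * (exp (- ((sqrt (s p))\<^sup>2 / 2)) - exp (- ((sqrt (s q))\<^sup>2 / 2)))\<^sup>2"
    unfolding rec(3)[OF p] rec(3)[OF q] right_diff_distrib[symmetric] power_mult_distrib
    using nonneg by simp
  also have "\<dots> \<le> l * \<gamma> vs * (exp (- 1) * (sqrt (s p) - sqrt (s q))\<^sup>2)"
    using nonneg by (intro mult_left_mono exp_neg_half_square_lipschitz)
  also have "\<dots> \<le> l * \<gamma> vs * (exp (- 1) * (\<integral>w. (h p w - h q w)\<^sup>2 \<partial>\<mu>))"
    unfolding s_def using nonneg rec[OF p] rec[OF q]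
    by (intro mult_left_mono sqrt_integral_diff_le) auto
  also have "\<dots> = l * \<gamma> vs / exp 1 * (\<integral>w. (h p w - h q w)\<^sup>2 \<partial>\<mu>)"
    by (simp add: exp_minus divide_inverse)
  finally have "ennreal ((sqrt (p vs) - sqrt (q vs))\<^sup>2)
      \<le> ennreal (l * \<gamma> vs / exp 1) * ennreal (\<integral>w. (h p w - h q w)\<^sup>2 \<partial>\<mu>)"
    using nonneg by (simp add: ennreal_leI flip: ennreal_mult'')
  \<comment> \<open>Only this inequality is needed, and it holds even if the right side is
    infinite.\<close>
  also have "ennreal (\<integral>w. (h p w - h q w)\<^sup>2 \<partial>\<mu>) \<le> (\<integral>\<^sup>+ w. ennreal ((h p w - h q w)\<^sup>2) \<partial>\<mu>)"
  proof -
    have "(\<integral>w. (h p w - h q w)\<^sup>2 \<partial>\<mu>) = enn2real (\<integral>\<^sup>+ w. ennreal ((h p w - h q w)\<^sup>2) \<partial>\<mu>)"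
      using rec(1)[OF p] rec(1)[OF q] by (intro integral_eq_nn_integral) auto
    then show ?thesis by (simp add: ennreal_enn2real_if)
  qed
  also have "(\<lambda>w. (h p w - h q w)\<^sup>2)
      = (\<lambda>w. K (last vs) w * (sqrt (p (vs @ [w])) - sqrt (q (vs @ [w])))\<^sup>2)"
    by (simp add: h_def real_sqrt_mult power_mult_distrib flip: left_diff_distrib)
      (simp add: mult.commute)
  finally show ?thesis by (simp add: mult_left_mono)
qed

text \<open>The bound keeps the factor \<open>\<gamma> vs\<close>: applied to
  \<open>vs @ [w]\<close>, it supplies exactly the damping weight in the integral that defines
  \<open>W (Suc k) vs\<close>.\<close>

lemma sqrt_tree_recursion_diff_le_W:
  assumes p: "tree_recursion \<mu> \<phi> l \<gamma> p" and q: "tree_recursion \<mu> \<phi> l \<gamma> q" and "0 \<le> l"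
  shows "vs \<noteq> [] \<Longrightarrow> ennreal ((sqrt (p vs) - sqrt (q vs))\<^sup>2)
    \<le> ennreal (l * \<gamma> vs * (l / exp 1) ^ k) * W k vs"
proof (induction k arbitrary: vs)
  case 0
  have "0 \<le> sqrt (p vs)" "0 \<le> sqrt (q vs)" "sqrt (p vs) \<le> sqrt (l * \<gamma> vs)" "sqrt (q vs) \<le> sqrt (l * \<gamma> vs)"
    using tree_recursionD(2)[OF p 0] tree_recursionD(2)[OF q 0]
      tree_recursion_le[OF p \<open>0 \<le> l\<close> 0] tree_recursion_le[OF q \<open>0 \<le> l\<close> 0] by auto
  then have "\<bar>sqrt (p vs) - sqrt (q vs)\<bar> \<le> sqrt (l * \<gamma> vs)" by linarith
  then have "(sqrt (p vs) - sqrt (q vs))\<^sup>2 \<le> l * \<gamma> vs"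
    using \<open>0 \<le> l\<close> gamma_nonneg[OF 0] by (simp add: real_le_rsqrt sqrt_ge_absD)
  then show ?case by (simp add: ennreal_leI)
next
  case (Suc k)
  let ?d = "\<lambda>vs. (sqrt (p vs) - sqrt (q vs))\<^sup>2"
  let ?c = "l * (l / exp 1) ^ k"
  have "ennreal (K (last vs) w * ?d (vs @ [w]))
      \<le> ennreal ?c * (ennreal (\<gamma> (vs @ [w]) * K (last vs) w) * W k (vs @ [w]))" for w
  proof -
    have "ennreal (K (last vs) w * ?d (vs @ [w]))
        \<le> ennreal (K (last vs) w) * (ennreal (l * \<gamma> (vs @ [w]) * (l / exp 1) ^ k) * W k (vs @ [w]))"
      using Suc.IH[of "vs @ [w]"] by (simp add: ennreal_mult mult_left_mono)
    also have "\<dots> = ennreal ?c * (ennreal (\<gamma> (vs @ [w]) * K (last vs) w) * W k (vs @ [w]))"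
      using \<open>0 \<le> l\<close> gamma_nonneg[of "vs @ [w]"] by (simp add: ennreal_mult ac_simps)
    finally show ?thesis .
  qed
  then have "(\<integral>\<^sup>+ w. ennreal (K (last vs) w * ?d (vs @ [w])) \<partial>\<mu>) \<le> ennreal ?c * W (Suc k) vs"
    by (subst W.simps, subst nn_integral_cmult[symmetric]) (auto intro!: nn_integral_mono)
  then have "ennreal (?d vs) \<le> ennreal (l * \<gamma> vs / exp 1) * (ennreal ?c * W (Suc k) vs)"
    using sqrt_tree_recursion_contraction[OF p q \<open>0 \<le> l\<close> Suc.prems]
    by (meson mult_left_mono order_trans zero_le)
  also have "\<dots> = ennreal (l * \<gamma> vs * (l / exp 1) ^ Suc k) * W (Suc k) vs"
  proof -
    have "0 \<le> l * \<gamma> vs / exp 1" "0 \<le> ?c"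
      using \<open>0 \<le> l\<close> gamma_nonneg[OF Suc.prems] by simp_all
    moreover have "l * \<gamma> vs * (l / exp 1) ^ Suc k = l * \<gamma> vs / exp 1 * ?c" by simp
    ultimately show ?thesis by (simp only: ennreal_mult mult.assoc)
  qed
  finally show ?case .
qed

section \<open>Decay of the bound and uniqueness\<close>

text \<open>For r slightly above the connective constant, \<open>V\<close> is eventually at most
  r^k, so the squared difference is at most l (l r / e)^k, which tends to 0 when l r < e.\<close>

lemma tree_recursion_unique:
  assumes p: "tree_recursion \<mu> \<phi> l \<gamma> p" and q: "tree_recursion \<mu> \<phi> l \<gamma> q" and "0 \<le> l"
    and l: "ennreal l < ennreal (exp 1) / connective_const \<mu> \<phi> \<gamma>" and vs: "vs \<noteq> []"
  shows "p vs = q vs"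
proof -
  let ?v = "\<lambda>k. enn2real (V \<mu> \<phi> \<gamma> k)"
  obtain L where L: "0 \<le> L" "connective_const \<mu> \<phi> \<gamma> = ennreal L" "(\<lambda>k. root k (?v k)) \<longlonglongrightarrow> L"
    by (rule root_V_tendsto)
  have "l * L < exp 1"
  \<comment> \<open>For L = 0 the quotient e/L is infinite and l L = 0; otherwise it is a real
    quotient.\<close>
  proof (cases "L = 0")
    case False
    then show ?thesis
      using l L \<open>0 \<le> l\<close> by (simp add: divide_ennreal ennreal_less_iff field_simps)
  qed simp
  obtain r where r: "L < r" "l * r < exp 1"
  \<comment> \<open>Division by 0 gives 0 in the reals, so e/l bounds r from above only for l > 0;
    for l = 0 any r > L will do.\<close>
  proof (cases "l = 0")
    case True
    then show thesis using that[of "L + 1"] by simp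
  next
    case False
    then have "L < exp 1 / l" using \<open>l * L < exp 1\<close> \<open>0 \<le> l\<close> by (simp add: field_simps)
    then obtain r where "L < r" "r < exp 1 / l" using dense by blast
    then show thesis using that[of r] False \<open>0 \<le> l\<close> by (simp add: field_simps)
  qed
  have "0 < r" using L r by simp
  have "eventually (\<lambda>k. (sqrt (p vs) - sqrt (q vs))\<^sup>2 \<le> l * (l * r / exp 1) ^ k) sequentially"
    using order_tendstoD(2)[OF L(3) r(1)] eventually_gt_at_top[of 0]
  proof eventually_elim
    case (elim k)
    \<comment> \<open>This uses k > 0, because \<open>root 0\<close> is constantly 0.\<close>
    have "?v k = root k (?v k) ^ k" using elim by simp
    also have "\<dots> \<le> r ^ k" using elim by (intro power_mono) auto
    finally have v: "?v k \<le> r ^ k" .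
    have "W k vs \<le> ennreal (?v k)"
      using W_le_V[OF vs, of k] V_finite[of k] by (simp add: ennreal_enn2real_if)
    also have "\<dots> \<le> ennreal (r ^ k)" using v by (rule ennreal_leI)
    finally have W: "W k vs \<le> ennreal (r ^ k)" .
    have "l * \<gamma> vs * (l / exp 1) ^ k \<le> l * 1 * (l / exp 1) ^ k"
      using \<open>0 \<le> l\<close> gamma_le_1[OF vs] by (intro mult_right_mono mult_left_mono) auto
    then have "ennreal (l * \<gamma> vs * (l / exp 1) ^ k) \<le> ennreal (l * (l / exp 1) ^ k)"
      by (intro ennreal_leI) simp
    then have "ennreal ((sqrt (p vs) - sqrt (q vs))\<^sup>2) \<le> ennreal (l * (l / exp 1) ^ k) * ennreal (r ^ k)"
      using sqrt_tree_recursion_diff_le_W[OF p q \<open>0 \<le> l\<close> vs, of k] W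
      by (meson mult_mono order_trans zero_le)
    also have "\<dots> = ennreal (l * (l * r / exp 1) ^ k)"
      using \<open>0 \<le> l\<close> \<open>0 < r\<close> by (simp add: power_mult_distrib power_divide flip: ennreal_mult)
    finally show ?case
      using \<open>0 \<le> l\<close> \<open>0 < r\<close> by (subst (asm) ennreal_le_iff) auto
  qed
  moreover have "(\<lambda>k. l * (l * r / exp 1) ^ k) \<longlonglongrightarrow> l * 0"
    using \<open>0 \<le> l\<close> \<open>0 < r\<close> r by (intro tendsto_intros LIMSEQ_realpow_zero) auto
  ultimately have "(sqrt (p vs) - sqrt (q vs))\<^sup>2 \<le> l * 0"
    using tendsto_lowerbound trivial_limit_sequentially by blast
  then show ?thesis by simp
qed

end

theorem theorem8:
  fixes \<mu> :: "'a::polish_space measure"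
    and \<phi> :: "'a \<Rightarrow> 'a \<Rightarrow> ereal"
    and \<gamma> \<pi>\<^sub>1 \<pi>\<^sub>2 :: "'a list \<Rightarrow> real"
    and lam :: real
  assumes "locally_finite_borel \<mu>"
    and "dist_pushforwards_ac \<mu>"
    and "potential \<phi>" and "repulsive \<phi>" and "tempered \<mu> \<phi>"
    and "damping_function \<gamma>"
    and "lam \<ge> 0"
    and "ennreal lam < ennreal (exp 1) / connective_const \<mu> \<phi> \<gamma>"
    and "tree_recursion \<mu> \<phi> lam \<gamma> \<pi>\<^sub>1"
    and "tree_recursion \<mu> \<phi> lam \<gamma> \<pi>\<^sub>2"
  shows "\<forall>vs. vs \<noteq> [] \<longrightarrow> \<pi>\<^sub>1 vs = \<pi>\<^sub>2 vs"
proof -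
  interpret damped_potential \<mu> \<phi> \<gamma>
    using assms by unfold_locales
  show ?thesis
    using tree_recursion_unique assms by blast
qed

end
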